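(* Let $d\geq 1$ and let $K\subset\mathbb{R}^d$ be the non-singleton attractor of a finite iterated function system $\Phi=\{\phi_i\}_{i=1}^m$ of contracting similitudes on $\mathbb{R}^d$. Suppose that $\Phi$ satisfies the open set condition, but does not satisfy the strong separation condition. Then $K$ is not the attractor of any finite iterated function system $\Psi$ of contracting similitudes on $\mathbb{R}^d$ satisfying the strong separation condition.
   Context: A contracting similitude on $\mathbb{R}^d$ is a map of the form $\phi(x)=aOx+t$ with $0<a<1$, $t\in\mathbb{R}^d$ and $O$ an orthogonal transformation of $\mathbb{R}^d$; $a$ is its contraction ratio. An iterated function system (IFS) of contracting similitudes on $\mathbb{R}^d$ is a finite family $\Phi=\{\phi_i\}_{i=1}^m$, $m\geq 2$, of contracting similitudes on $\mathbb{R}^d$ (contraction ratios and orthogonal parts may vary with $i$). Its attractor is the unique non-empty compact set $K\subset\mathbb{R}^d$ with $K=\bigcup_{i=1}^m\phi_i(K)$; one then says that $\Phi$ generates $K$. $\Phi$ satisfies the open set condition (OSC) if there is a non-empty open set $U\subset\mathbb{R}^d$ such that $\phi_1(U),\ldots,\phi_m(U)$ are pairwise disjoint subsets of $U$. $\Phi$ satisfies the strong separation condition (SSC) if $\phi_1(K),\ldots,\phi_m(K)$ are pairwise disjoint (i.e. $\phi_i(K)\cap\phi_{i'}(K)=\varnothing$ for all $i\neq i'$), where $K$ is the attractor of $\Phi$. *)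

theory Defs
  imports "HOL-Analysis.Analysis"
begin

definition contracting_similitude :: "(real ^ 'd \<Rightarrow> real ^ 'd) \<Rightarrow> bool" where
  "contracting_similitude f \<longleftrightarrow>
     (\<exists>a Q t. 0 < a \<and> a < 1 \<and> orthogonal_transformation Q \<and> f = (\<lambda>x. a *\<^sub>R Q x + t))"

text \<open>A family of \<open>m\<close> maps is a function on \<open>nat\<close> of which only the values at
  \<open>1, \<dots>, m\<close> matter; repeated maps are allowed.\<close>

definition similitude_IFS :: "nat \<Rightarrow> (nat \<Rightarrow> real ^ 'd \<Rightarrow> real ^ 'd) \<Rightarrow> bool" where
  "similitude_IFS m \<phi> \<longleftrightarrow> m \<ge> 2 \<and> (\<forall>i\<in>{1..m}. contracting_similitude (\<phi> i))"

definition is_attractor ::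
    "nat \<Rightarrow> (nat \<Rightarrow> real ^ 'd \<Rightarrow> real ^ 'd) \<Rightarrow> (real ^ 'd) set \<Rightarrow> bool" where
  "is_attractor m \<phi> K \<longleftrightarrow> K \<noteq> {} \<and> compact K \<and> K = (\<Union>i\<in>{1..m}. \<phi> i ` K)"

definition open_set_condition :: "nat \<Rightarrow> (nat \<Rightarrow> real ^ 'd \<Rightarrow> real ^ 'd) \<Rightarrow> bool" where
  "open_set_condition m \<phi> \<longleftrightarrow>
     (\<exists>U. open U \<and> U \<noteq> {} \<and> (\<forall>i\<in>{1..m}. \<phi> i ` U \<subseteq> U) \<and>
          disjoint_family_on (\<lambda>i. \<phi> i ` U) {1..m})"

text \<open>The bound \<open>K\<close> is the attractor of the IFS, which is unique: see
  \<open>is_attractor_unique\<close> below.\<close>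

definition strong_separation_condition :: "nat \<Rightarrow> (nat \<Rightarrow> real ^ 'd \<Rightarrow> real ^ 'd) \<Rightarrow> bool" where
  "strong_separation_condition m \<phi> \<longleftrightarrow>
     (\<exists>K. is_attractor m \<phi> K \<and> disjoint_family_on (\<lambda>i. \<phi> i ` K) {1..m})"

lemma contracting_similitude_dist:
  assumes "contracting_similitude f"
  obtains a where "0 < a" "a < 1" "\<And>x y. dist (f x) (f y) = a * dist x y"
proof -
  from assms obtain a Q t where *: "0 < a" "a < 1" "orthogonal_transformation Q"
      "f = (\<lambda>x. a *\<^sub>R Q x + t)"
    unfolding contracting_similitude_def by blast
  have "dist (f x) (f y) = a * dist x y" for x y
  proof -
    have "dist (Q x) (Q y) = dist x y"
      using *(3) by (metis orthogonal_transformation_isometry)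
    then show ?thesis
      using * by (simp add: dist_norm flip: scaleR_diff_right)
  qed
  with * show ?thesis using that by blast
qed

lemma is_attractor_subset:
  assumes "similitude_IFS m \<phi>" "is_attractor m \<phi> K" "is_attractor m \<phi> L"
  shows "K \<subseteq> L"
proof -
  have K: "K \<noteq> {}" "compact K" "K = (\<Union>i\<in>{1..m}. \<phi> i ` K)"
    and L: "L \<noteq> {}" "compact L" "L = (\<Union>i\<in>{1..m}. \<phi> i ` L)"
    using assms unfolding is_attractor_def by auto
  have "continuous_on K (\<lambda>x. infdist x L)"
    by (intro continuous_intros)
  then obtain x where x: "x \<in> K" "\<And>y. y \<in> K \<Longrightarrow> infdist y L \<le> infdist x L"
    using continuous_attains_sup[OF K(2,1)] by blast
  obtain i y where i: "i \<in> {1..m}" "y \<in> K" "x = \<phi> i y"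
    using K(3) x(1) by blast
  obtain a where a: "0 < a" "a < 1" "\<And>u v. dist (\<phi> i u) (\<phi> i v) = a * dist u v"
    using contracting_similitude_dist assms(1) i(1) unfolding similitude_IFS_def by metis
  obtain z where z: "z \<in> L" "infdist y L = dist y z"
    using infdist_attains_inf[OF compact_imp_closed[OF L(2)] L(1)] by blast
  have "\<phi> i z \<in> L" using L(3) z(1) i(1) by blast
  then have "infdist x L \<le> dist x (\<phi> i z)" by (rule infdist_le)
  also have "\<dots> = a * infdist y L" by (simp add: i(3) a(3) z(2))
  also have "\<dots> \<le> a * infdist x L" using x(2)[OF i(2)] a(1) by simp
  finally have "(1 - a) * infdist x L \<le> 0" by (simp add: algebra_simps)
  then have "infdist x L \<le> 0" using a(2) by (simp add: mult_le_0_iff)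
  then have "infdist y L = 0" if "y \<in> K" for y
    using x(2)[OF that] infdist_nonneg[of y L] by linarith
  then show ?thesis
    using in_closed_iff_infdist_zero[OF compact_imp_closed[OF L(2)] L(1)] by blast
qed

lemma is_attractor_unique:
  assumes "similitude_IFS m \<phi>" "is_attractor m \<phi> K" "is_attractor m \<phi> L"
  shows "K = L"
  using is_attractor_subset[OF assms] is_attractor_subset[OF assms(1,3,2)] by blast

end

theory Submission
  imports Defs
begin

text \<open>
  Let \<open>c \<epsilon>\<close> be the number of \<open>\<epsilon>\<close>-chain components of \<open>K\<close>.
  If \<open>K\<close> is generated with ratios \<open>r\<^sub>j\<close> under strong separation, then \<open>c \<epsilon> = (\<Sum>j. c (\<epsilon> / r\<^sub>j))\<close> for
  small \<open>\<epsilon>\<close>, whence \<open>c \<epsilon> * \<epsilon>\<^sup>s\<close> is bounded, where \<open>(\<Sum>j. r\<^sub>j\<^sup>s) = 1\<close>. If \<open>K\<close> is also generated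
  with ratios \<open>a\<^sub>i\<close> and two of the pieces meet, then \<open>b \<epsilon> = (\<Sum>i. c (\<epsilon> / a\<^sub>i)) - c \<epsilon>\<close> is at least \<open>1\<close>
  at every scale. But \<open>b\<close> inherits the renewal equation of the \<open>r\<^sub>j\<close> from \<open>c\<close>, so in fact
  \<open>b \<epsilon> \<ge> \<kappa> * \<epsilon>\<^sup>-\<^sup>s\<close> with \<open>\<kappa> > 0\<close>. The open set condition gives \<open>(\<Sum>i. a\<^sub>i\<^sup>s) \<le> 1\<close>, by comparing
  packings of the open set by \<open>\<epsilon>\<close>-balls near \<open>K\<close> with \<open>c \<epsilon>\<close>. Hence \<open>c \<epsilon> * \<epsilon>\<^sup>s\<close> loses at least \<open>\<kappa>\<close> each
  time the scale shrinks by a fixed factor, which is absurd for a bounded nonnegative function.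
\<close>

section \<open>Chain components\<close>

text \<open>The closure relates every point of the type to itself; intersecting with
  \<open>S \<times> S\<close> leaves an equivalence relation on \<open>S\<close>.\<close>

definition chain_rel :: "real \<Rightarrow> 'a::metric_space set \<Rightarrow> ('a \<times> 'a) set" where
  "chain_rel e S = {(x, y). x \<in> S \<and> y \<in> S \<and> dist x y < e}\<^sup>* \<inter> S \<times> S"

definition ncomp :: "real \<Rightarrow> 'a::metric_space set \<Rightarrow> nat" where
  "ncomp e S = card (S // chain_rel e S)"

lemma chain_rel_induct [consumes 1, case_names refl step]:
  assumes "(x, y) \<in> chain_rel e S"
    and "x \<in> S \<Longrightarrow> P x"
    and "\<And>y z. (x, y) \<in> chain_rel e S \<Longrightarrow> P y \<Longrightarrow> z \<in> S \<Longrightarrow> dist y z < e \<Longrightarrow> P z"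
  shows "P y"
proof -
  have "(x, y) \<in> {(x, y). x \<in> S \<and> y \<in> S \<and> dist x y < e}\<^sup>*" and x: "x \<in> S"
    using assms(1) by (auto simp: chain_rel_def)
  then have "y \<in> S \<longrightarrow> P y"
  proof (induction rule: rtrancl_induct)
    case base
    then show ?case using assms(2) by blast
  next
    case (step y z)
    then show ?case using assms(3)[of y z] x by (auto simp: chain_rel_def)
  qed
  then show ?thesis using assms(1) by (auto simp: chain_rel_def)
qed

lemma chain_rel_refl: "x \<in> S \<Longrightarrow> (x, x) \<in> chain_rel e S"
  by (auto simp: chain_rel_def)

lemma chain_rel_link: "x \<in> S \<Longrightarrow> y \<in> S \<Longrightarrow> dist x y < e \<Longrightarrow> (x, y) \<in> chain_rel e S"
  by (auto simp: chain_rel_def)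

lemma chain_rel_trans: "(x, y) \<in> chain_rel e S \<Longrightarrow> (y, z) \<in> chain_rel e S \<Longrightarrow> (x, z) \<in> chain_rel e S"
  by (auto simp: chain_rel_def)

lemma chain_rel_in: "(x, y) \<in> chain_rel e S \<Longrightarrow> x \<in> S \<and> y \<in> S"
  by (auto simp: chain_rel_def)

lemma equiv_chain_rel: "equiv S (chain_rel e S)"
proof (rule equivI)
  have "sym ({(x, y). x \<in> S \<and> y \<in> S \<and> dist x y < e}\<^sup>*)"
    by (intro sym_rtrancl symI) (auto simp: dist_commute)
  then show "sym (chain_rel e S)"
    by (auto simp: chain_rel_def sym_def)
qed (auto simp: refl_on_def chain_rel_def trans_def)

lemma chain_rel_map:
  assumes "(x, y) \<in> chain_rel e S" "f ` S \<subseteq> T"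
    and "\<And>x y. x \<in> S \<Longrightarrow> y \<in> S \<Longrightarrow> dist x y < e \<Longrightarrow> dist (f x) (f y) < e'"
  shows "(f x, f y) \<in> chain_rel e' T"
  using assms(1)
proof (induction rule: chain_rel_induct)
  case refl
  then show ?case using assms(2) by (auto intro: chain_rel_refl)
next
  case (step y z)
  then show ?case
    using assms(2) chain_rel_in[OF step.hyps(1)] assms(3)
    by (intro chain_rel_trans[OF step.IH] chain_rel_link) auto
qed

lemma chain_rel_mono:
  assumes "(x, y) \<in> chain_rel e S" "S \<subseteq> T" "e \<le> e'"
  shows "(x, y) \<in> chain_rel e' T"
  using chain_rel_map[OF assms(1), of "\<lambda>x. x" T e'] assms(2,3) by auto

text \<open>A finite \<open>e\<close>-net in \<open>S\<close> meets every class, because each point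
  of \<open>S\<close> is one link away from the net.\<close>

lemma finite_chain_quotient:
  assumes "compact S" "0 < e"
  shows "finite (S // chain_rel e S)"
proof -
  obtain F where F: "finite F" "F \<subseteq> S" "S \<subseteq> (\<Union>x\<in>F. ball x e)"
    using compactE_image[OF assms(1), of S "\<lambda>x. ball x e"] assms(2)
    by (metis (no_types, lifting) UN_I centre_in_ball open_ball subsetI)
  have "S // chain_rel e S \<subseteq> (\<lambda>x. chain_rel e S `` {x}) ` F"
  proof
    fix X assume "X \<in> S // chain_rel e S"
    then obtain y where y: "y \<in> S" "X = chain_rel e S `` {y}"
      by (auto elim: quotientE)
    then obtain x where x: "x \<in> F" "dist x y < e" using F(3) by auto
    then have "(x, y) \<in> chain_rel e S" using F(2) y by (auto intro: chain_rel_link)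
    then have "X = chain_rel e S `` {x}"
      using equiv_class_eq[OF equiv_chain_rel] y(2) by metis
    then show "X \<in> (\<lambda>x. chain_rel e S `` {x}) ` F" using x by blast
  qed
  then show ?thesis using F(1) finite_surj by blast
qed

section \<open>Chain components of finite unions\<close>

text \<open>Enlarging a class of a piece to the class of the union containing it is a map
  \<open>F\<close> onto the classes of the union. Comparing the counts thus reduces to asking
  whether \<open>F\<close> is injective.\<close>

lemma chain_quotient_Un:
  fixes T :: "'i \<Rightarrow> 'a::metric_space set" and I :: "'i set" and e :: real
  defines "S \<equiv> \<Union>i\<in>I. T i"
  defines "F \<equiv> \<lambda>(i, X). chain_rel e S `` X"
  shows "S // chain_rel e S = F ` (SIGMA i:I. T i // chain_rel e (T i))"
    and "i \<in> I \<Longrightarrow> x \<in> T i \<Longrightarrow> F (i, chain_rel e (T i) `` {x}) = chain_rel e S `` {x}"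
proof -
  show *: "F (i, chain_rel e (T i) `` {x}) = chain_rel e S `` {x}"
    if i: "i \<in> I" "x \<in> T i" for i x
  proof -
    have "(x, y) \<in> chain_rel e S" if "(x, y) \<in> chain_rel e (T i)" for y
      using chain_rel_mono[OF that, of S e] i by (auto simp: S_def)
    then show ?thesis
      using i chain_rel_refl[of x "T i" e] by (auto simp: F_def intro: chain_rel_trans)
  qed
  show "S // chain_rel e S = F ` (SIGMA i:I. T i // chain_rel e (T i))"
  proof (intro equalityI subsetI)
    fix X assume "X \<in> S // chain_rel e S"
    then obtain i x where "i \<in> I" "x \<in> T i" "X = chain_rel e S `` {x}"
      by (auto elim!: quotientE simp: S_def)
    then show "X \<in> F ` (SIGMA i:I. T i // chain_rel e (T i))"
      using *[of i x] quotientI[of x "T i" "chain_rel e (T i)"] by (auto intro!: image_eqI)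
  next
    fix X assume "X \<in> F ` (SIGMA i:I. T i // chain_rel e (T i))"
    then obtain i x where "i \<in> I" "x \<in> T i" "X = F (i, chain_rel e (T i) `` {x})"
      by (auto elim!: quotientE)
    then show "X \<in> S // chain_rel e S"
      using * by (auto simp: S_def intro!: quotientI)
  qed
qed

text \<open>A point common to \<open>T i\<close> and \<open>T j\<close> lies in a class of each, and
  \<open>F\<close> merges these two classes.\<close>

lemma ncomp_Un_less:
  assumes I: "finite I" and T: "\<And>i. i \<in> I \<Longrightarrow> compact (T i)" and e: "0 < e"
    and ij: "i \<in> I" "j \<in> I" "i \<noteq> j" "T i \<inter> T j \<noteq> {}"
  shows "ncomp e (\<Union>i\<in>I. T i) < (\<Sum>i\<in>I. ncomp e (T i))"
proof -
  define S where "S = (\<Union>i\<in>I. T i)"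
  define F where "F = (\<lambda>(i::'a, X). chain_rel e S `` X)"
  define A where "A = (SIGMA i:I. T i // chain_rel e (T i))"
  have fin: "finite A" using I T e by (auto simp: A_def intro!: finite_chain_quotient)
  obtain x where x: "x \<in> T i" "x \<in> T j" using ij by blast
  note F = chain_quotient_Un[where I=I and T=T and e=e, folded S_def, folded F_def A_def]
  have "\<not> inj_on F A"
  proof
    assume "inj_on F A"
    moreover have "F (i, chain_rel e (T i) `` {x}) = F (j, chain_rel e (T j) `` {x})"
      using F(2) ij x by simp
    moreover have "(i, chain_rel e (T i) `` {x}) \<in> A" "(j, chain_rel e (T j) `` {x}) \<in> A"
      using ij x by (auto simp: A_def intro!: quotientI)
    ultimately show False using ij(3) by (auto dest: inj_onD)
  qed
  then have "card (F ` A) < card A"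
    using fin card_image_le[OF fin] eq_card_imp_inj_on[OF fin] by (metis le_neq_implies_less)
  also have "card A = (\<Sum>i\<in>I. ncomp e (T i))"
    using I T e by (simp add: A_def ncomp_def finite_chain_quotient)
  finally show ?thesis using F(1) by (simp add: ncomp_def S_def)
qed

text \<open>A link shorter than \<open>e\<close> cannot bridge a gap of width at least
  \<open>e\<close>, so a chain never leaves the piece in which it starts.\<close>

lemma chain_rel_separated:
  assumes "(x, y) \<in> chain_rel e (\<Union>i\<in>I. T i)" "i \<in> I" "x \<in> T i"
    and sep: "\<And>i j x y. i \<in> I \<Longrightarrow> j \<in> I \<Longrightarrow> i \<noteq> j \<Longrightarrow> x \<in> T i \<Longrightarrow> y \<in> T j \<Longrightarrow> e \<le> dist x y"
  shows "(x, y) \<in> chain_rel e (T i)"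
  using assms(1)
proof (induction rule: chain_rel_induct)
  case refl
  show ?case using assms(3) by (rule chain_rel_refl)
next
  case (step y z)
  then obtain j where j: "j \<in> I" "z \<in> T j" by blast
  have "y \<in> T i" using chain_rel_in[OF step.IH] by blast
  then have "j = i" using sep[of i j y z] j assms(2) step by force
  then show ?case using step j \<open>y \<in> T i\<close> by (auto intro: chain_rel_trans chain_rel_link)
qed

text \<open>Here \<open>F\<close> is injective: chains stay in one piece, and the positive gaps make
  the index of that piece unique.\<close>

lemma ncomp_Un_separated:
  assumes I: "finite I" and T: "\<And>i. i \<in> I \<Longrightarrow> compact (T i)" and e: "0 < e"
    and sep: "\<And>i j x y. i \<in> I \<Longrightarrow> j \<in> I \<Longrightarrow> i \<noteq> j \<Longrightarrow> x \<in> T i \<Longrightarrow> y \<in> T j \<Longrightarrow> e \<le> dist x y"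
  shows "ncomp e (\<Union>i\<in>I. T i) = (\<Sum>i\<in>I. ncomp e (T i))"
proof -
  define S where "S = (\<Union>i\<in>I. T i)"
  define F where "F = (\<lambda>(i::'a, X). chain_rel e S `` X)"
  define A where "A = (SIGMA i:I. T i // chain_rel e (T i))"
  note F = chain_quotient_Un[where I=I and T=T and e=e, folded S_def, folded F_def A_def]
  have "inj_on F A"
  proof (rule inj_onI)
    fix p q assume pq: "p \<in> A" "q \<in> A" "F p = F q"
    obtain i x where i: "i \<in> I" "x \<in> T i" "p = (i, chain_rel e (T i) `` {x})"
      using pq by (auto simp: A_def elim!: quotientE)
    obtain j y where j: "j \<in> I" "y \<in> T j" "q = (j, chain_rel e (T j) `` {y})"
      using pq by (auto simp: A_def elim!: quotientE)
    have "chain_rel e S `` {x} = chain_rel e S `` {y}"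
      using F(2) i j pq by simp
    then have "(x, y) \<in> chain_rel e S"
      using j chain_rel_refl[of y S e] by (auto simp: S_def)
    then have xy: "(x, y) \<in> chain_rel e (T i)"
      using chain_rel_separated[where T=T and I=I and i=i, OF _ i(1,2) sep] by (simp add: S_def)
    then have "y \<in> T i" using chain_rel_in by fast
    then have "i = j" using sep[of i j y y] i j e by force
    then show "p = q" using i j equiv_class_eq[OF equiv_chain_rel xy] by simp
  qed
  then have "card (F ` A) = card A" by (rule card_image)
  also have "card A = (\<Sum>i\<in>I. ncomp e (T i))"
    using I T e by (simp add: A_def ncomp_def finite_chain_quotient)
  finally show ?thesis using F(1) by (simp add: ncomp_def S_def)
qed

section \<open>Chain components under maps and similitudes\<close>

text \<open>A map turning \<open>e\<close>-links into \<open>e'\<close>-links carries chains to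
  chains, hence induces a map of classes, which is onto since \<open>f\<close> is onto
  \<open>T\<close>.\<close>

lemma ncomp_map_le:
  assumes "compact S" "0 < e" "f ` S = T"
    and "\<And>x y. x \<in> S \<Longrightarrow> y \<in> S \<Longrightarrow> dist x y < e \<Longrightarrow> dist (f x) (f y) < e'"
  shows "ncomp e' T \<le> ncomp e S"
proof -
  have "T // chain_rel e' T \<subseteq> (\<lambda>X. chain_rel e' T `` (f ` X)) ` (S // chain_rel e S)"
  proof
    fix Y assume "Y \<in> T // chain_rel e' T"
    then obtain x where x: "x \<in> S" "Y = chain_rel e' T `` {f x}"
      using assms(3) by (auto elim: quotientE)
    have "(f x, f y) \<in> chain_rel e' T" if "(x, y) \<in> chain_rel e S" for y
      using chain_rel_map[OF that] assms(3,4) by blast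
    then have "Y = chain_rel e' T `` (f ` (chain_rel e S `` {x}))"
      using x chain_rel_refl[of x S e] by (auto intro: chain_rel_trans)
    then show "Y \<in> (\<lambda>X. chain_rel e' T `` (f ` X)) ` (S // chain_rel e S)"
      using x by (auto intro: quotientI)
  qed
  then show ?thesis
    unfolding ncomp_def using finite_chain_quotient[OF assms(1,2)] surj_card_le by blast
qed

lemma ncomp_antimono:
  assumes "compact S" "0 < e" "e \<le> e'"
  shows "ncomp e' S \<le> ncomp e S"
  using assms by (intro ncomp_map_le[where f="\<lambda>x. x"]) auto

lemma chain_rel_similar:
  assumes "(f x, f y) \<in> chain_rel e (f ` S)" "0 < a"
    and f: "\<And>x y. dist (f x) (f y) = a * dist x y"
  shows "(x, y) \<in> chain_rel (e / a) S"
proof -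
  have "inj f" using f assms(2) by (intro injI) (metis dist_eq_0_iff mult_eq_0_iff less_irrefl)
  then have inv: "the_inv f (f x) = x" for x by (rule the_inv_f_f)
  show ?thesis
    using chain_rel_map[OF assms(1), of "the_inv f" S "e / a"] assms(2)
    by (force simp: inv f image_image pos_less_divide_eq mult.commute)
qed

lemma compact_similar_image:
  fixes f :: "'a::metric_space \<Rightarrow> 'b::metric_space"
  assumes "compact K" "0 < a" "\<And>x y. dist (f x) (f y) = a * dist x y"
  shows "compact (f ` K)"
proof -
  have "a-lipschitz_on K f" using assms by (intro lipschitz_onI) auto
  then show ?thesis using assms(1) compact_continuous_image lipschitz_on_continuous_on by blast
qed

lemma ncomp_similar:
  assumes "compact S" "0 < e" "0 < a" and f: "\<And>x y. dist (f x) (f y) = a * dist x y"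
  shows "ncomp e (f ` S) = ncomp (e / a) S"
proof (rule antisym)
  show "ncomp e (f ` S) \<le> ncomp (e / a) S"
    using assms by (intro ncomp_map_le[where f=f]) (auto simp: field_simps)
  have "inj f" using f assms(3) by (intro injI) (metis dist_eq_0_iff mult_eq_0_iff less_irrefl)
  then have inv: "the_inv f (f x) = x" for x by (rule the_inv_f_f)
  have "compact (f ` S)" using assms(1,3) f by (rule compact_similar_image)
  then show "ncomp (e / a) S \<le> ncomp e (f ` S)"
    using assms by (intro ncomp_map_le[where f="the_inv f"]) (auto simp: inv field_simps image_image)
qed

lemma separated_compact_family:
  fixes T :: "'i \<Rightarrow> 'a::heine_borel set"
  assumes "finite I" "\<And>i. i \<in> I \<Longrightarrow> compact (T i)" "disjoint_family_on T I"
  obtains \<delta> where "0 < \<delta>"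
    "\<And>i j x y. i \<in> I \<Longrightarrow> j \<in> I \<Longrightarrow> i \<noteq> j \<Longrightarrow> x \<in> T i \<Longrightarrow> y \<in> T j \<Longrightarrow> \<delta> \<le> dist x y"
proof -
  define A where "A = {(i, j). i \<in> I \<and> j \<in> I \<and> i \<noteq> j}"
  have "\<forall>p\<in>A. \<exists>d>0. \<forall>x\<in>T (fst p). \<forall>y\<in>T (snd p). d \<le> dist x y"
  proof
    fix p assume "p \<in> A"
    then obtain i j where ij: "p = (i, j)" "i \<in> I" "j \<in> I" "i \<noteq> j" by (auto simp: A_def)
    then have "T i \<inter> T j = {}" using assms(3) by (simp add: disjoint_family_on_def)
    then show "\<exists>d>0. \<forall>x\<in>T (fst p). \<forall>y\<in>T (snd p). d \<le> dist x y"
      using separate_compact_closed[of "T i" "T j"] assms(2) ij compact_imp_closed by auto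
  qed
  then obtain d where d: "\<And>p. p \<in> A \<Longrightarrow> 0 < d p \<and> (\<forall>x\<in>T (fst p). \<forall>y\<in>T (snd p). d p \<le> dist x y)"
    by metis
  have "A \<subseteq> I \<times> I" by (auto simp: A_def)
  then have fin: "finite A" using assms(1) by (meson finite_SigmaI finite_subset)
  show ?thesis
  proof (rule that)
    \<comment> \<open>The \<open>1\<close> keeps the minimum defined when there is no pair of
      distinct indices.\<close>
    show "0 < Min (insert 1 (d ` A))" using d fin by auto
    fix i j x y assume "i \<in> I" "j \<in> I" "i \<noteq> j" and xy: "x \<in> T i" "y \<in> T j"
    then have *: "(i, j) \<in> A" by (simp add: A_def)
    then have "Min (insert 1 (d ` A)) \<le> d (i, j)" using fin by (intro Min_le) auto
    also have "\<dots> \<le> dist x y" using d[OF *] xy by auto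
    finally show "Min (insert 1 (d ` A)) \<le> dist x y" .
  qed
qed

section \<open>Renewal inequalities\<close>

text \<open>Dividing by \<open>q < 1\<close> coarsens the scale by a fixed factor, so finitely many
  steps lead from any \<open>e\<close> up to the window \<open>(e0, e1]\<close>: after
  \<open>n\<close> rounds the claim holds above \<open>e0 * q ^ n\<close>, which tends to 0.\<close>

lemma scale_induct:
  fixes q e0 e1 :: real
  assumes "0 < q" "q < 1" "0 < e0"
    and base: "\<And>e. e0 < e \<Longrightarrow> e \<le> e1 \<Longrightarrow> P e"
    and step: "\<And>e. 0 < e \<Longrightarrow> e \<le> e0 \<Longrightarrow> (\<And>e'. e / q \<le> e' \<Longrightarrow> e' \<le> e1 \<Longrightarrow> P e') \<Longrightarrow> P e"
    and e: "0 < e" "e \<le> e1"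
  shows "P e"
proof -
  have *: "\<forall>e. e0 * q ^ n < e \<and> e \<le> e1 \<longrightarrow> P e" for n
  proof (induction n)
    case 0
    then show ?case using base by simp
  next
    case (Suc n)
    show ?case
    proof (intro allI impI, elim conjE)
      fix e assume e: "e0 * q ^ Suc n < e" "e \<le> e1"
      have "0 < e0 * q ^ Suc n" using assms by simp
      then have e_pos: "0 < e" using e by linarith
      show "P e"
      proof (cases "e \<le> e0")
        case True
        show ?thesis
        proof (rule step[OF e_pos True])
          fix e' assume e': "e / q \<le> e'" "e' \<le> e1"
          have "e0 * q ^ n < e / q" using e assms(1) by (simp add: field_simps)
          then show "P e'" using Suc e' by auto
        qed
      next
        case False
        then show ?thesis using base e by simp
      qed
    qed
  qed
  have "(\<lambda>n. e0 * q ^ n) \<longlonglongrightarrow> e0 * 0"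
    using assms by (intro tendsto_intros LIMSEQ_power_zero) auto
  then have "eventually (\<lambda>n. e0 * q ^ n < e) sequentially"
    using e by (intro order_tendstoD) auto
  then obtain n where "e0 * q ^ n < e" by (auto simp: eventually_sequentially)
  then show ?thesis using * e by blast
qed

lemma finite_ratio_bounds:
  fixes r :: "'i \<Rightarrow> real"
  assumes "finite J" "\<And>j. j \<in> J \<Longrightarrow> 0 < r j \<and> r j < 1"
  obtains l q where "0 < l" "q < 1" "0 < q" "l < 1" "\<And>j. j \<in> J \<Longrightarrow> l \<le> r j \<and> r j \<le> q"
proof
  \<comment> \<open>Inserting \<open>1/2\<close> covers an empty \<open>J\<close> and forces
    \<open>?l < 1\<close> and \<open>0 < ?q\<close>.\<close>
  let ?l = "Min (insert (1/2) (r ` J))" and ?q = "Max (insert (1/2) (r ` J))"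
  show "0 < ?l" "?q < 1" using assms by auto
  have "?l \<le> 1/2" "1/2 \<le> ?q" using assms(1) by (simp_all only: Min_le Max_ge finite_insert finite_imageI insertI1)
  then show "0 < ?q" "?l < 1" by linarith+
  show "?l \<le> r j \<and> r j \<le> ?q" if "j \<in> J" for j using assms(1) that by auto
qed

text \<open>The bound on the window \<open>(e0, e0 / l]\<close> passes to finer scales because each
  \<open>e / r j\<close> lies between \<open>e / q\<close> and \<open>e0 / l\<close>. The weight
  condition is phrased with \<open>S\<close> so that a negative \<open>S\<close> admits total weight
  above 1; applied to a negated function, this yields lower bounds.\<close>

lemma subrenewal_bound:
  fixes r p :: "'i \<Rightarrow> real" and f :: "real \<Rightarrow> real"
  assumes r: "finite J" "\<And>j. j \<in> J \<Longrightarrow> l \<le> r j \<and> r j \<le> q" "0 < l" "0 < q" "q < 1"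
    and p: "\<And>j. j \<in> J \<Longrightarrow> 0 \<le> p j" "(\<Sum>j\<in>J. p j) * S \<le> S"
    and f: "\<And>e. 0 < e \<Longrightarrow> e \<le> e0 \<Longrightarrow> f e \<le> (\<Sum>j\<in>J. p j * f (e / r j))"
    and base: "\<And>e. e0 < e \<Longrightarrow> e \<le> e0 / l \<Longrightarrow> f e \<le> S"
    and e0: "0 < e0" and e: "0 < e" "e \<le> e0 / l"
  shows "f e \<le> S"
proof (rule scale_induct[where P="\<lambda>e. f e \<le> S", OF \<open>0 < q\<close> \<open>q < 1\<close> e0 base _ e])
  fix e assume e: "0 < e" "e \<le> e0" and IH: "\<And>e'. e / q \<le> e' \<Longrightarrow> e' \<le> e0 / l \<Longrightarrow> f e' \<le> S"
  have "f e \<le> (\<Sum>j\<in>J. p j * f (e / r j))" using f e by simp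
  also have "\<dots> \<le> (\<Sum>j\<in>J. p j * S)"
  proof (intro sum_mono mult_left_mono p IH)
    fix j assume j: "j \<in> J"
    then have "0 < r j" using r(2)[OF j] r(3) by linarith
    then show "e / q \<le> e / r j" "e / r j \<le> e0 / l"
      using r(2)[OF j] r(3) e by (auto intro!: frac_le)
  qed
  also have "\<dots> \<le> S" using p(2) by (simp add: sum_distrib_right)
  finally show "f e \<le> S" .
qed

text \<open>Each use of the inequality lowers the upper bound for \<open>f\<close> by \<kappa>, at
  the cost of shrinking the range of scales by the factor \<open>l\<close>. Eventually the bound is
  negative, against \<open>0 \<le> f e\<close>.\<close>

lemma no_negative_drift:
  fixes r p :: "'i \<Rightarrow> real" and f :: "real \<Rightarrow> real"
  assumes r: "finite J" "\<And>j. j \<in> J \<Longrightarrow> l \<le> r j" "0 < l" "l < 1"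
    and p: "\<And>j. j \<in> J \<Longrightarrow> 0 \<le> p j" "(\<Sum>j\<in>J. p j) \<le> 1"
    and f: "\<And>e. 0 < e \<Longrightarrow> e \<le> e0 \<Longrightarrow> f e \<le> (\<Sum>j\<in>J. p j * f (e / r j)) - \<kappa>"
    and bound: "\<And>e. 0 < e \<Longrightarrow> e \<le> e0 \<Longrightarrow> 0 \<le> f e \<and> f e \<le> S"
    and pos: "0 < e0" "0 < \<kappa>"
  shows False
proof -
  have *: "\<exists>d>0. d \<le> e0 \<and> (\<forall>e. 0 < e \<and> e \<le> d \<longrightarrow> f e \<le> S - real n * \<kappa>)" for n
  proof (induction n)
    case 0
    then show ?case using bound pos by auto
  next
    case (Suc n)
    then obtain d where d: "0 < d" "d \<le> e0" "\<And>e. 0 < e \<Longrightarrow> e \<le> d \<Longrightarrow> f e \<le> S - real n * \<kappa>"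
      by blast
    \<comment> \<open>The total weight is only known to be at most 1, so multiplying by it preserves
      the bound only when the bound is nonnegative.\<close>
    have S: "0 \<le> S - real n * \<kappa>" using d(3)[of d] bound[of d] d by linarith
    have "f e \<le> S - real (Suc n) * \<kappa>" if e: "0 < e" "e \<le> d * l" for e
    proof -
      have ed: "e \<le> d" using e d(1) r(4) mult_left_le[of l d] by linarith
      have "f e \<le> (\<Sum>j\<in>J. p j * f (e / r j)) - \<kappa>" using f e ed d by simp
      also have "(\<Sum>j\<in>J. p j * f (e / r j)) \<le> (\<Sum>j\<in>J. p j * (S - real n * \<kappa>))"
      proof (intro sum_mono mult_left_mono p d(3))
        fix j assume j: "j \<in> J"
        have rj: "0 < r j" using r(2)[OF j] r(3) by linarith
        then show "0 < e / r j" using e by simp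
        have "e \<le> d * r j" using e d(1) r(2)[OF j] by (meson mult_left_mono order_trans less_imp_le)
        then show "e / r j \<le> d" using rj by (simp add: field_simps)
      qed
      also have "\<dots> \<le> S - real n * \<kappa>"
        using p(2) S mult_right_mono[OF p(2) S] by (simp add: sum_distrib_right)
      finally show ?thesis by (simp add: algebra_simps)
    qed
    moreover have "0 < d * l" "d * l \<le> e0"
      using d(1,2) r(3,4) order_trans[OF mult_left_le[of l d] d(2)] by simp_all
    ultimately show ?case by blast
  qed
  obtain n :: nat where n: "S < real n * \<kappa>" using reals_Archimedean3[OF pos(2)] by blast
  obtain d where d: "0 < d" "d \<le> e0" "f d \<le> S - real n * \<kappa>"
    using *[of n] by (meson order_refl)
  then show False using bound[of d] n by linarith
qed

section \<open>The Moran exponent and normalised renewal equations\<close>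

text \<open>Intermediate value theorem: the sum is \<open>card J\<close> at exponent 0 and drops
  below 1 at a large integer exponent.\<close>

lemma Moran_exponent_exists:
  fixes r :: "'i \<Rightarrow> real"
  assumes J: "finite J" "1 \<le> card J" and r: "\<And>j. j \<in> J \<Longrightarrow> 0 < r j \<and> r j < 1"
  obtains s where "0 \<le> s" "(\<Sum>j\<in>J. r j powr s) = 1"
proof -
  have "(\<lambda>n. \<Sum>j\<in>J. r j ^ n) \<longlonglongrightarrow> (\<Sum>j\<in>J. 0)"
    using r by (intro tendsto_sum LIMSEQ_power_zero) force
  then have "eventually (\<lambda>n. (\<Sum>j\<in>J. r j ^ n) < 1) sequentially"
    by (intro order_tendstoD) auto
  then obtain n where n: "(\<Sum>j\<in>J. r j ^ n) < 1"
    by (auto simp: eventually_sequentially)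
  have r0: "(\<Sum>j\<in>J. r j powr 0) = card J"
  proof -
    have "(\<Sum>j\<in>J. r j powr 0) = (\<Sum>j\<in>J. 1)" using r by (intro sum.cong) force+
    then show ?thesis by simp
  qed
  have "\<exists>s\<ge>0. s \<le> real n \<and> (\<Sum>j\<in>J. r j powr s) = 1"
  proof (rule IVT2')
    show "(\<Sum>j\<in>J. r j powr real n) \<le> 1" using n r by (simp add: powr_realpow)
    show "1 \<le> (\<Sum>j\<in>J. r j powr 0)" using r0 J by simp
    show "continuous_on {0..real n} (\<lambda>s. \<Sum>j\<in>J. r j powr s)"
      using r by (intro continuous_intros) force+
  qed simp
  then show ?thesis using that by blast
qed

text \<open>With \<open>x = c (e / t)\<close>, this turns a term of a renewal equation for
  \<open>c\<close> into a term of weight \<open>t powr s\<close> for the normalised function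
  \<open>c e * e powr s\<close>.\<close>

lemma powr_rescale:
  "0 < t \<Longrightarrow> 0 < e \<Longrightarrow> t powr s * (x * (e / t) powr s) = x * e powr s" for t e s x :: real
  by (simp add: powr_divide)

text \<open>The normalised function satisfies a renewal equation with weights
  \<open>r j powr s\<close> of total 1, so a bound on \<open>(\<delta>, \<delta> / l]\<close>
  persists; monotonicity of \<open>c\<close> and of the power provides that bound.\<close>

lemma renewal_growth_bound:
  fixes r :: "'j \<Rightarrow> real" and c :: "real \<Rightarrow> real"
  assumes J: "finite J" "\<And>j. j \<in> J \<Longrightarrow> 0 < r j \<and> r j < 1"
    and s: "0 \<le> s" "(\<Sum>j\<in>J. r j powr s) = 1"
    and c: "\<And>e. 0 < e \<Longrightarrow> 0 \<le> c e" "\<And>e e'. 0 < e \<Longrightarrow> e \<le> e' \<Longrightarrow> c e' \<le> c e"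
    and \<delta>: "0 < \<delta>" and c_r: "\<And>e. 0 < e \<Longrightarrow> e \<le> \<delta> \<Longrightarrow> c e = (\<Sum>j\<in>J. c (e / r j))"
  obtains S where "\<And>e. 0 < e \<Longrightarrow> e \<le> \<delta> \<Longrightarrow> c e * e powr s \<le> S"
proof -
  obtain l q where l: "0 < l" "q < 1" "0 < q" "l < 1" "\<And>j. j \<in> J \<Longrightarrow> l \<le> r j \<and> r j \<le> q"
    using finite_ratio_bounds[of J r] J by metis
  show ?thesis
  proof (rule that)
    fix e assume e: "0 < e" "e \<le> \<delta>"
    show "c e * e powr s \<le> c \<delta> * (\<delta> / l) powr s"
    proof (rule subrenewal_bound[where f="\<lambda>e. c e * e powr s" and r=r and p="\<lambda>j. r j powr s",
          OF J(1) l(5,1,3,2)])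
      show "c e * e powr s \<le> (\<Sum>j\<in>J. r j powr s * (c (e / r j) * (e / r j) powr s))"
        if e: "0 < e" "e \<le> \<delta>" for e
      proof -
        have "(\<Sum>j\<in>J. r j powr s * (c (e / r j) * (e / r j) powr s)) = (\<Sum>j\<in>J. c (e / r j) * e powr s)"
          using e J by (intro sum.cong powr_rescale) auto
        then show ?thesis using e c_r by (simp add: sum_distrib_right)
      qed
      show "c e * e powr s \<le> c \<delta> * (\<delta> / l) powr s" if "\<delta> < e" "e \<le> \<delta> / l" for e
        using that \<delta> s c by (intro mult_mono powr_mono2) auto
      have "\<delta> \<le> \<delta> / l" using \<delta> l by (simp add: field_simps)
      then show "e \<le> \<delta> / l" using e by simp
    qed (use e s \<delta> in auto)
  qed
qed

text \<open>The analytic core of the contradiction: the geometry enters only through the two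
  relations \<open>c_r\<close> and \<open>c_a\<close> and the bound on the weights of the
  \<open>a i\<close>.\<close>

lemma incompatible_renewal:
  fixes a :: "'i \<Rightarrow> real" and r :: "'j \<Rightarrow> real" and c :: "real \<Rightarrow> real"
  assumes I: "finite I" "\<And>i. i \<in> I \<Longrightarrow> 0 < a i \<and> a i < 1"
    and J: "finite J" "\<And>j. j \<in> J \<Longrightarrow> 0 < r j \<and> r j < 1"
    and s: "0 \<le> s" "(\<Sum>j\<in>J. r j powr s) = 1" "(\<Sum>i\<in>I. a i powr s) \<le> 1"
    and c: "\<And>e. 0 < e \<Longrightarrow> 0 \<le> c e" "\<And>e e'. 0 < e \<Longrightarrow> e \<le> e' \<Longrightarrow> c e' \<le> c e"
    and \<delta>: "0 < \<delta>" and c_r: "\<And>e. 0 < e \<Longrightarrow> e \<le> \<delta> \<Longrightarrow> c e = (\<Sum>j\<in>J. c (e / r j))"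
    and c_a: "\<And>e. 0 < e \<Longrightarrow> c e + 1 \<le> (\<Sum>i\<in>I. c (e / a i))"
  shows False
proof -
  obtain l q where l: "0 < l" "q < 1" "0 < q" "l < 1" "\<And>j. j \<in> J \<Longrightarrow> l \<le> r j \<and> r j \<le> q"
    using finite_ratio_bounds[of J r] J by metis
  obtain l' q' where l': "0 < l'" "q' < 1" "0 < q'" "l' < 1" "\<And>i. i \<in> I \<Longrightarrow> l' \<le> a i \<and> a i \<le> q'"
    using finite_ratio_bounds[of I a] I by metis
  define f where "f e = c e * e powr s" for e
  define b where "b e = (\<Sum>i\<in>I. c (e / a i)) - c e" for e
  \<comment> \<open>For \<open>e \<le> \<delta>'\<close> each \<open>e / a i\<close> is at most
    \<delta>, so \<open>c_r\<close> applies to every term of \<open>b e\<close>.\<close>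
  define \<delta>' where "\<delta>' = \<delta> * l'"
  have \<delta>': "0 < \<delta>'" "\<delta>' \<le> \<delta>"
    using \<delta> l' mult_left_le[of l' \<delta>] by (auto simp: \<delta>'_def)

  obtain S where f_bound: "\<And>e. 0 < e \<Longrightarrow> e \<le> \<delta> \<Longrightarrow> f e \<le> S"
    using renewal_growth_bound[OF J s(1,2) c \<delta> c_r] unfolding f_def by blast

  \<comment> \<open>Dividing by \<open>a i\<close> and by \<open>r j\<close> commutes, so the two
    sums can be exchanged.\<close>
  have b_r: "b e = (\<Sum>j\<in>J. b (e / r j))" if e: "0 < e" "e \<le> \<delta>'" for e
  proof -
    have "c (e / a i) = (\<Sum>j\<in>J. c (e / r j / a i))" if i: "i \<in> I" for i
    proof -
      have "e \<le> \<delta> * a i"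
        using e l'(5)[OF i] \<delta> unfolding \<delta>'_def by (meson mult_left_mono order_trans less_imp_le)
      then have "c (e / a i) = (\<Sum>j\<in>J. c (e / a i / r j))"
        using I(2)[OF i] e by (intro c_r) (auto simp: field_simps)
      then show ?thesis by (simp add: mult.commute)
    qed
    then have "(\<Sum>i\<in>I. c (e / a i)) = (\<Sum>j\<in>J. \<Sum>i\<in>I. c (e / r j / a i))"
      by (simp add: sum.swap[of _ I])
    then show ?thesis using c_r[of e] e \<delta>' by (simp add: b_def sum_subtractf)
  qed

  \<comment> \<open>Negation turns the lower bound into the form of \<open>subrenewal_bound\<close>;
    on the initial window it follows from \<open>1 \<le> b e\<close> and
    \<open>\<delta>' < e\<close>.\<close>
  have b_bound: "- (b e * e powr s) \<le> - (\<delta>' powr s)" if "0 < e" "e \<le> \<delta>' / l" for e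
  proof (rule subrenewal_bound[where f="\<lambda>e. - (b e * e powr s)" and r=r and p="\<lambda>j. r j powr s", OF J(1) l(5,1,3,2)])
    show "- (b e * e powr s) \<le> (\<Sum>j\<in>J. r j powr s * - (b (e / r j) * (e / r j) powr s))"
      if e: "0 < e" "e \<le> \<delta>'" for e
    proof -
      have "(\<Sum>j\<in>J. r j powr s * (b (e / r j) * (e / r j) powr s)) = (\<Sum>j\<in>J. b (e / r j) * e powr s)"
        using e J by (intro sum.cong powr_rescale) auto
      then show ?thesis using e b_r by (simp add: sum_distrib_right sum_negf)
    qed
    show "- (b e * e powr s) \<le> - (\<delta>' powr s)" if e: "\<delta>' < e" "e \<le> \<delta>' / l" for e
    proof -
      have "1 \<le> b e" using c_a[of e] e \<delta>' by (simp add: b_def)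
      moreover have "\<delta>' powr s \<le> e powr s" using e \<delta>' s by (intro powr_mono2) auto
      ultimately show ?thesis using mult_mono[of 1 "b e" "\<delta>' powr s" "e powr s"] by simp
    qed
  qed (use that s \<delta>' in auto)

  have sub: "x \<le> x / l" if "0 < x" for x :: real
    using that l by (simp add: field_simps)
  show False
  \<comment> \<open>The weighted sum of \<open>f\<close> over the scales \<open>e / a i\<close>
    exceeds \<open>f e\<close> by exactly \<open>b e * e powr s\<close>, which supplies the
    drift.\<close>
  proof (rule no_negative_drift[where f=f and r=a and p="\<lambda>i. a i powr s" and J=I, OF I(1) _ l'(1,4)])
    show "f e \<le> (\<Sum>i\<in>I. a i powr s * f (e / a i)) - \<delta>' powr s" if e: "0 < e" "e \<le> \<delta>'" for e
    proof -
      have "(\<Sum>i\<in>I. a i powr s * f (e / a i)) = (\<Sum>i\<in>I. c (e / a i) * e powr s)"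
        unfolding f_def using e I by (intro sum.cong powr_rescale) auto
      then have "(\<Sum>i\<in>I. a i powr s * f (e / a i)) - f e = b e * e powr s"
        by (simp add: f_def b_def sum_distrib_right left_diff_distrib)
      then show ?thesis using b_bound[of e] e sub[of \<delta>'] \<delta>' by simp
    qed
    show "0 \<le> f e \<and> f e \<le> S" if "0 < e" "e \<le> \<delta>'" for e
      using that f_bound[of e] c(1)[of e] \<delta>' by (simp add: f_def)
    show "0 < \<delta>' powr s" using \<delta>' by simp
  qed (use \<delta>' s l' in auto)
qed

section \<open>Packings and the open set condition\<close>

text \<open>For \<open>e \<le> \<delta>\<close> a chain stays in the image of one
  \<open>\<psi> j\<close>, and pulling it back gives a chain at scale \<open>e / r j\<close>; the
  bound is linear in the scale, so the factor \<open>r j\<close> cancels. For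
  \<open>e > \<delta>\<close> the diameter of \<open>K\<close> suffices.\<close>

lemma chain_diameter:
  assumes K: "compact K" "K = (\<Union>j\<in>J. \<psi> j ` K)"
    and J: "finite J" "\<And>j. j \<in> J \<Longrightarrow> 0 < r j \<and> r j < 1"
    and \<psi>: "\<And>j x y. j \<in> J \<Longrightarrow> dist (\<psi> j x) (\<psi> j y) = r j * dist x y"
    and \<delta>: "0 < \<delta>" "\<And>i j x y. i \<in> J \<Longrightarrow> j \<in> J \<Longrightarrow> i \<noteq> j \<Longrightarrow> x \<in> \<psi> i ` K \<Longrightarrow> y \<in> \<psi> j ` K \<Longrightarrow> \<delta> \<le> dist x y"
    and e: "0 < e" and xy: "(x, y) \<in> chain_rel e K"
  shows "dist x y \<le> diameter K / \<delta> * e"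
proof -
  obtain l q where l: "0 < l" "q < 1" "0 < q" "l < 1" "\<And>j. j \<in> J \<Longrightarrow> l \<le> r j \<and> r j \<le> q"
    using finite_ratio_bounds[of J r] J by metis
  \<comment> \<open>\<open>\<delta> / l\<close> bounds the scales reached by pulling back; the
    maximum includes the given \<open>e\<close>.\<close>
  define e1 where "e1 = max e (\<delta> / l)"
  have "\<forall>x y. (x, y) \<in> chain_rel e K \<longrightarrow> dist x y \<le> diameter K / \<delta> * e"
  proof (rule scale_induct[of q \<delta> e1
        "\<lambda>e. \<forall>x y. (x, y) \<in> chain_rel e K \<longrightarrow> dist x y \<le> diameter K / \<delta> * e", OF l(3,2) \<delta>(1)])
    fix e assume e: "\<delta> < e"
    show "\<forall>x y. (x, y) \<in> chain_rel e K \<longrightarrow> dist x y \<le> diameter K / \<delta> * e"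
    proof (intro allI impI)
      fix x y assume "(x, y) \<in> chain_rel e K"
      then have "dist x y \<le> diameter K"
        using chain_rel_in diameter_bounded_bound[OF compact_imp_bounded[OF K(1)]] by fast
      moreover have "diameter K * \<delta> \<le> diameter K * e"
        using e diameter_ge_0[OF compact_imp_bounded[OF K(1)]] by (intro mult_left_mono) auto
      ultimately show "dist x y \<le> diameter K / \<delta> * e"
        using \<delta>(1) order_trans[OF mult_right_mono[of "dist x y" "diameter K" \<delta>]] by (simp add: pos_le_divide_eq)
    qed
  next
    fix e assume e: "0 < e" "e \<le> \<delta>"
      and IH: "\<And>e'. e / q \<le> e' \<Longrightarrow> e' \<le> e1 \<Longrightarrow>
        \<forall>x y. (x, y) \<in> chain_rel e' K \<longrightarrow> dist x y \<le> diameter K / \<delta> * e'"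
    show "\<forall>x y. (x, y) \<in> chain_rel e K \<longrightarrow> dist x y \<le> diameter K / \<delta> * e"
    proof (intro allI impI)
      fix x y assume xy: "(x, y) \<in> chain_rel e K"
      then obtain j x' where j: "j \<in> J" "x' \<in> K" "x = \<psi> j x'"
        using K(2) chain_rel_in by blast
      have "(x, y) \<in> chain_rel e (\<psi> j ` K)"
      proof (rule chain_rel_separated[where T="\<lambda>j. \<psi> j ` K" and I=J])
        show "(x, y) \<in> chain_rel e (\<Union>j\<in>J. \<psi> j ` K)" using xy K(2) by simp
        show "e \<le> dist u v" if "i \<in> J" "j \<in> J" "i \<noteq> j" "u \<in> \<psi> i ` K" "v \<in> \<psi> j ` K" for i j u v
          using \<delta>(2)[OF that] e by simp
      qed (use j in auto)
      moreover from this obtain y' where y': "y = \<psi> j y'" using chain_rel_in by blast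
      ultimately have "(x', y') \<in> chain_rel (e / r j) K"
        using j J \<psi> by (intro chain_rel_similar[of "\<psi> j"]) auto
      moreover have "e / q \<le> e / r j"
        using e l(5)[OF j(1)] l(1) by (intro divide_left_mono) auto
      moreover have "e / r j \<le> \<delta> / l"
        using e l(5)[OF j(1)] l(1) by (intro frac_le) auto
      ultimately have "dist x' y' \<le> diameter K / \<delta> * (e / r j)"
        using IH[of "e / r j"] by (simp add: e1_def)
      then have "r j * dist x' y' \<le> r j * (diameter K / \<delta> * (e / r j))"
        using J(2)[OF j(1)] by (intro mult_left_mono) auto
      then show "dist x y \<le> diameter K / \<delta> * e"
        using j y' \<psi>[OF j(1)] J(2)[OF j(1)] by simp
    qed
  qed (use e in \<open>auto simp: e1_def\<close>)
  then show ?thesis using xy by blast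
qed

text \<open>Volume comparison: the disjoint balls all lie in a ball of radius
  \<open>(\<bar>R\<bar> + 1) * e\<close>, where the absolute value keeps the radius positive for
  every real \<open>R\<close>.\<close>

lemma card_disjoint_balls_le:
  fixes E :: "'a::euclidean_space set"
  assumes E: "finite E" "E \<subseteq> cball z (R * e)" "disjoint_family_on (\<lambda>x. ball x e) E"
    and e: "0 < e"
  shows "real (card E) \<le> (\<bar>R\<bar> + 1) ^ DIM('a)"
proof -
  have "(\<Sum>x\<in>E. measure lborel (ball x e)) = measure lborel (\<Union>x\<in>E. ball x e)"
    using E by (intro measure_UNION'[symmetric])
      (auto simp: disjoint_family_on_def pairwise_def disjnt_def intro!: fmeasurableI emeasure_bounded_finite)
  also have "\<dots> \<le> measure lborel (ball z ((\<bar>R\<bar> + 1) * e))"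
  proof (rule measure_mono_fmeasurable)
    show "(\<Union>x\<in>E. ball x e) \<subseteq> ball z ((\<bar>R\<bar> + 1) * e)"
    proof
      fix y assume "y \<in> (\<Union>x\<in>E. ball x e)"
      then obtain x where "x \<in> E" "dist x y < e" by auto
      moreover from this have "dist z x \<le> \<bar>R\<bar> * e"
        using E(2) order_trans[OF _ mult_right_mono[OF abs_ge_self[of R], of e]] e by auto
      ultimately show "y \<in> ball z ((\<bar>R\<bar> + 1) * e)"
        using dist_triangle[of z y x] by (simp add: algebra_simps)
    qed
  qed (auto intro!: fmeasurableI emeasure_bounded_finite borel_open)
  finally have "real (card E) * (unit_ball_vol (DIM('a)) * e ^ DIM('a)) \<le> unit_ball_vol (DIM('a)) * ((\<bar>R\<bar> + 1) * e) ^ DIM('a)"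
    using e by (simp add: content_ball)
  then have "real (card E) * (unit_ball_vol (DIM('a)) * e ^ DIM('a)) \<le> (\<bar>R\<bar> + 1) ^ DIM('a) * (unit_ball_vol (DIM('a)) * e ^ DIM('a))"
    by (simp add: power_mult_distrib mult_ac)
  moreover have "0 < unit_ball_vol (DIM('a)) * e ^ DIM('a)" using e by simp
  ultimately show ?thesis using mult_le_cancel_right_pos by blast
qed

section \<open>Packings of the open set near \<open>K\<close>\<close>

text \<open>\<open>E\<close> holds the centres. The open set need not meet \<open>K\<close>, so
  centres are only kept within \<open>C * e\<close> of it, a condition that scales under
  similitudes.\<close>

definition ball_packing :: "'a::metric_space set \<Rightarrow> 'a set \<Rightarrow> real \<Rightarrow> real \<Rightarrow> 'a set \<Rightarrow> bool" where
  "ball_packing U K C e E \<longleftrightarrow> finite E \<and> disjoint_family_on (\<lambda>x. ball x e) E \<and>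
     (\<forall>x\<in>E. ball x e \<subseteq> U \<and> (\<exists>k\<in>K. dist x k \<le> C * e))"

text \<open>Assign each centre to the chain component of a nearby point of \<open>K\<close>. Centres
  assigned to one component lie in a ball of radius \<open>(C + D) * e\<close>, so volume limits
  their number.\<close>

lemma ball_packing_card_le:
  fixes K U E :: "'a::euclidean_space set"
  assumes K: "compact K" and e: "0 < e"
    and diam: "\<And>x y. (x, y) \<in> chain_rel e K \<Longrightarrow> dist x y \<le> D * e"
    and E: "ball_packing U K C e E"
  shows "real (card E) \<le> (\<bar>C + D\<bar> + 1) ^ DIM('a) * ncomp e K"
proof -
  obtain k where k: "\<And>x. x \<in> E \<Longrightarrow> k x \<in> K \<and> dist x (k x) \<le> C * e"
    using E unfolding ball_packing_def by metis
  define E' where "E' X = {x \<in> E. k x \<in> X}" for X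
  have "E = (\<Union>X\<in>K // chain_rel e K. E' X)"
    using k Union_quotient[OF equiv_chain_rel, of K e] by (auto simp: E'_def)
  then have "card E \<le> (\<Sum>X\<in>K // chain_rel e K. card (E' X))"
    using card_UN_le[OF finite_chain_quotient[OF K e], of E'] by simp
  then have "real (card E) \<le> (\<Sum>X\<in>K // chain_rel e K. real (card (E' X)))"
    by (simp flip: of_nat_sum)
  also have "\<dots> \<le> (\<Sum>X\<in>K // chain_rel e K. (\<bar>C + D\<bar> + 1) ^ DIM('a))"
  proof (rule sum_mono)
    fix X assume "X \<in> K // chain_rel e K"
    then obtain z where z: "z \<in> K" "X = chain_rel e K `` {z}" by (auto elim: quotientE)
    show "real (card (E' X)) \<le> (\<bar>C + D\<bar> + 1) ^ DIM('a)"
    proof (rule card_disjoint_balls_le[OF _ _ _ e])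
      show "E' X \<subseteq> cball z ((C + D) * e)"
      proof
        fix x assume x: "x \<in> E' X"
        then have "dist z (k x) \<le> D * e" using diam z by (auto simp: E'_def)
        moreover have "dist x (k x) \<le> C * e" using k x by (auto simp: E'_def)
        ultimately show "x \<in> cball z ((C + D) * e)"
          using dist_triangle2[of z x "k x"] by (simp add: algebra_simps)
      qed
    qed (use E in \<open>auto simp: E'_def ball_packing_def disjoint_family_on_def\<close>)
  qed
  finally show ?thesis by (simp add: ncomp_def mult.commute)
qed

lemma similar_image_ball:
  fixes f :: "'a::metric_space \<Rightarrow> 'a"
  assumes "surj f" "0 < a" "\<And>x y. dist (f x) (f y) = a * dist x y"
  shows "f ` ball x (e / a) = ball (f x) e"
proof (intro equalityI subsetI)
  fix y assume "y \<in> ball (f x) e"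
  moreover obtain z where z: "y = f z" using assms(1) by (meson surjD)
  ultimately have "dist x z < e / a" using assms(2,3) by (simp add: pos_less_divide_eq mult.commute)
  then show "y \<in> f ` ball x (e / a)" using z by simp
next
  fix y assume "y \<in> f ` ball x (e / a)"
  then obtain z where "y = f z" "dist x z < e / a" by auto
  then show "y \<in> ball (f x) e" using assms(2,3) by (simp add: pos_less_divide_eq mult.commute)
qed

text \<open>Packing sizes are superadditive: \<open>\<phi> i\<close> carries a packing at scale
  \<open>e / a i\<close> to scale \<open>e\<close> with the same \<open>C\<close>, and different
  images cannot interfere because the images of \<open>U\<close> are disjoint.\<close>

lemma ball_packing_Un:
  fixes \<phi> :: "'i \<Rightarrow> 'a::metric_space \<Rightarrow> 'a"
  assumes I: "finite I" "\<And>i. i \<in> I \<Longrightarrow> 0 < a i"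
    and \<phi>: "\<And>i. i \<in> I \<Longrightarrow> surj (\<phi> i)" "\<And>i x y. i \<in> I \<Longrightarrow> dist (\<phi> i x) (\<phi> i y) = a i * dist x y"
    and K: "\<And>i. i \<in> I \<Longrightarrow> \<phi> i ` K \<subseteq> K"
    and U: "\<And>i. i \<in> I \<Longrightarrow> \<phi> i ` U \<subseteq> U" "disjoint_family_on (\<lambda>i. \<phi> i ` U) I"
    and E: "\<And>i. i \<in> I \<Longrightarrow> ball_packing U K C (e / a i) (E i)" and e: "0 < e"
  shows "ball_packing U K C e (\<Union>i\<in>I. \<phi> i ` E i)"
    and "card (\<Union>i\<in>I. \<phi> i ` E i) = (\<Sum>i\<in>I. card (E i))"
proof -
  have inj: "inj (\<phi> i)" if "i \<in> I" for i
    using \<phi>(2)[OF that] I(2)[OF that]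
    by (intro injI) (metis dist_eq_0_iff mult_eq_0_iff less_irrefl)
  have ball: "ball (\<phi> i x) e = \<phi> i ` ball x (e / a i)" if "i \<in> I" for i x
    using similar_image_ball[OF \<phi>(1) I(2) \<phi>(2)] that by simp
  have sub: "ball (\<phi> i x) e \<subseteq> \<phi> i ` U" if "i \<in> I" "x \<in> E i" for i x
    using E[OF that(1)] that by (auto simp: ball ball_packing_def)
  have disj: "ball (\<phi> i x) e \<inter> ball (\<phi> j y) e = {}"
    if "i \<in> I" "j \<in> I" "x \<in> E i" "y \<in> E j" "\<phi> i x \<noteq> \<phi> j y" for i j x y
  proof (cases "i = j")
    case True
    then have "ball x (e / a i) \<inter> ball y (e / a i) = {}"
      using E[OF that(1)] that unfolding ball_packing_def disjoint_family_on_def by metis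
    moreover have "ball (\<phi> i x) e \<inter> ball (\<phi> j y) e = \<phi> i ` (ball x (e / a i) \<inter> ball y (e / a i))"
      using True that(1) by (simp only: ball image_Int[OF inj])
    ultimately show ?thesis by simp
  next
    case False
    then have "\<phi> i ` U \<inter> \<phi> j ` U = {}" using that U(2) by (simp add: disjoint_family_on_def)
    then show ?thesis using sub[OF that(1,3)] sub[OF that(2,4)] by blast
  qed
  have near: "\<exists>k\<in>K. dist (\<phi> i x) k \<le> C * e" if i: "i \<in> I" "x \<in> E i" for i x
  proof -
    obtain k where "k \<in> K" "dist x k \<le> C * (e / a i)"
      using E[OF i(1)] i(2) unfolding ball_packing_def by blast
    then show ?thesis
      using K[OF i(1)] \<phi>(2)[OF i(1)] I(2)[OF i(1)]
      by (intro bexI[of _ "\<phi> i k"]) (auto simp: field_simps)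
  qed
  show "ball_packing U K C e (\<Union>i\<in>I. \<phi> i ` E i)"
    unfolding ball_packing_def
  proof (intro conjI ballI)
    show "finite (\<Union>i\<in>I. \<phi> i ` E i)" using I E by (auto simp: ball_packing_def)
    show "disjoint_family_on (\<lambda>x. ball x e) (\<Union>i\<in>I. \<phi> i ` E i)"
      using disj by (auto simp: disjoint_family_on_def)
  next
    fix x assume "x \<in> (\<Union>i\<in>I. \<phi> i ` E i)"
    then obtain i y where "i \<in> I" "y \<in> E i" "x = \<phi> i y" by auto
    then show "ball x e \<subseteq> U" "\<exists>k\<in>K. dist x k \<le> C * e"
      using sub U(1) near by blast+
  qed
  have "\<phi> i ` E i \<inter> \<phi> j ` E j = {}" if "i \<in> I" "j \<in> I" "i \<noteq> j" for i j
  proof -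
    have "\<phi> i ` E i \<subseteq> \<phi> i ` U" if "i \<in> I" for i
      using sub[OF that] e by (meson centre_in_ball image_subsetI subsetD)
    moreover have "\<phi> i ` U \<inter> \<phi> j ` U = {}" using that U(2) by (simp add: disjoint_family_on_def)
    ultimately show ?thesis using that by blast
  qed
  then have "card (\<Union>i\<in>I. \<phi> i ` E i) = (\<Sum>i\<in>I. card (\<phi> i ` E i))"
    using I E by (intro card_UN_disjoint) (auto simp: ball_packing_def)
  then show "card (\<Union>i\<in>I. \<phi> i ` E i) = (\<Sum>i\<in>I. card (E i))"
    using inj by (auto intro!: sum.cong card_image intro: inj_on_subset)
qed

text \<open>With total weight above 1, superadditivity would make the maximal packing size,
  normalised by \<open>e powr s\<close>, grow without bound.\<close>

lemma OSC_exponent_le: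
  fixes \<phi> :: "'i \<Rightarrow> 'a::metric_space \<Rightarrow> 'a"
  assumes I: "finite I" "\<And>i. i \<in> I \<Longrightarrow> 0 < a i \<and> a i < 1"
    and \<phi>: "\<And>i. i \<in> I \<Longrightarrow> surj (\<phi> i)" "\<And>i x y. i \<in> I \<Longrightarrow> dist (\<phi> i x) (\<phi> i y) = a i * dist x y"
    and K: "K \<noteq> {}" "\<And>i. i \<in> I \<Longrightarrow> \<phi> i ` K \<subseteq> K"
    and U: "open U" "U \<noteq> {}" "\<And>i. i \<in> I \<Longrightarrow> \<phi> i ` U \<subseteq> U" "disjoint_family_on (\<lambda>i. \<phi> i ` U) I"
    and \<delta>: "0 < \<delta>" and s: "0 \<le> s"
    and bound: "\<And>C. \<exists>B. \<forall>e E. 0 < e \<and> e \<le> \<delta> \<and> ball_packing U K C e E \<longrightarrow> card E * e powr s \<le> B"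
  shows "(\<Sum>i\<in>I. a i powr s) \<le> 1"
proof (rule ccontr)
  define \<theta> where "\<theta> = (\<Sum>i\<in>I. a i powr s)"
  assume "\<not> (\<Sum>i\<in>I. a i powr s) \<le> 1"
  then have \<theta>: "1 < \<theta>" by (simp add: \<theta>_def)
  obtain l q where l: "0 < l" "q < 1" "0 < q" "l < 1" "\<And>i. i \<in> I \<Longrightarrow> l \<le> a i \<and> a i \<le> q"
    using finite_ratio_bounds[of I a] I by metis
  obtain u \<beta> where u: "0 < \<beta>" "ball u \<beta> \<subseteq> U"
    using U(1,2) by (meson openE ex_in_conv)
  obtain k where k: "k \<in> K" using K(1) by blast
  \<comment> \<open>Balls about \<open>u\<close> of radius at most \<open>e1\<close> lie in
    \<open>U\<close>, and the assumed bound holds at these scales; the factor \<open>l\<close> in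
    \<open>e0\<close> ensures \<open>e / a i \<le> e1\<close> for \<open>e \<le> e0\<close>.\<close>
  define e1 where "e1 = min \<beta> \<delta>"
  define e0 where "e0 = e1 * l"
  have e1: "0 < e1" "e1 \<le> \<beta>" "e1 \<le> \<delta>" using u \<delta> by (auto simp: e1_def)
  have e0: "0 < e0" "e0 / l = e1" "e0 \<le> e1"
    using e1 l mult_left_le[of l e1] by (auto simp: e0_def)
  \<comment> \<open>This \<open>C\<close> makes the singleton of \<open>u\<close> a packing at every
    scale in \<open>(e0, e1]\<close>.\<close>
  define C where "C = dist u k / e0"
  obtain B where B: "\<And>e E. 0 < e \<Longrightarrow> e \<le> \<delta> \<Longrightarrow> ball_packing U K C e E \<Longrightarrow> card E * e powr s \<le> B"
    using bound[of C] by blast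
  \<comment> \<open>\<open>Max\<close> is meaningful for \<open>0 < e\<close> and
    \<open>e \<le> e1\<close>: \<open>B\<close> limits the sizes, and the empty packing
    exists.\<close>
  define M where "M e = Max (card ` Collect (ball_packing U K C e))" for e
  have fin: "finite (card ` Collect (ball_packing U K C e))" if e: "0 < e" "e \<le> e1" for e
  proof -
    have "card E \<le> nat \<lceil>B / e powr s\<rceil>" if "ball_packing U K C e E" for E
    proof -
      have "real (card E) \<le> B / e powr s" using B[OF _ _ that] e e1 by (simp add: pos_le_divide_eq)
      then show ?thesis by linarith
    qed
    then have "card ` Collect (ball_packing U K C e) \<subseteq> {..nat \<lceil>B / e powr s\<rceil>}" by blast
    then show ?thesis using finite_subset by blast
  qed
  have M_ge: "card E \<le> M e" if "0 < e" "e \<le> e1" "ball_packing U K C e E" for e E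
    unfolding M_def by (intro Max_ge fin that imageI CollectI)
  have M_ex: "\<exists>E. ball_packing U K C e E \<and> card E = M e" if "0 < e" "e \<le> e1" for e
  proof -
    have "ball_packing U K C e {}" by (simp add: ball_packing_def disjoint_family_on_def)
    then have "card ` Collect (ball_packing U K C e) \<noteq> {}" by blast
    then have "M e \<in> card ` Collect (ball_packing U K C e)"
      unfolding M_def by (intro Max_in fin that)
    then show ?thesis by auto
  qed
  define f where "f e = M e * e powr s" for e
  have f_le: "f e \<le> B" if "0 < e" "e \<le> e1" for e
    using M_ex[OF that] B that e1 unfolding f_def by (metis order_trans)
  have super: "(\<Sum>i\<in>I. a i powr s * f (e / a i)) \<le> f e" if e: "0 < e" "e \<le> e0" for e
  proof -
    have ea: "0 < e / a i \<and> e / a i \<le> e1" if i: "i \<in> I" for i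
    proof -
      have "e / a i \<le> e0 / l" using e l(1) l(5)[OF i] by (intro frac_le) auto
      then show ?thesis using e I(2)[OF i] e0 by simp
    qed
    then have "\<exists>E. ball_packing U K C (e / a i) E \<and> card E = M (e / a i)" if "i \<in> I" for i
      using M_ex that by blast
    then obtain E where E: "\<And>i. i \<in> I \<Longrightarrow> ball_packing U K C (e / a i) (E i)"
        "\<And>i. i \<in> I \<Longrightarrow> card (E i) = M (e / a i)"
      by metis
    have a_pos: "0 < a i" if "i \<in> I" for i using I(2)[OF that] by simp
    note Un = ball_packing_Un[where I=I and a=a and \<phi>=\<phi> and E=E, OF I(1) a_pos \<phi> K(2) U(3,4) E(1) e(1)]
    have "(\<Sum>i\<in>I. M (e / a i)) = (\<Sum>i\<in>I. card (E i))" using E(2) by simp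
    also have "\<dots> = card (\<Union>i\<in>I. \<phi> i ` E i)" by (rule Un(2)[symmetric])
    also have "\<dots> \<le> M e" using e e0 by (intro M_ge Un(1)) auto
    finally have "real (\<Sum>i\<in>I. M (e / a i)) * e powr s \<le> M e * e powr s"
      by (intro mult_right_mono of_nat_mono) auto
    moreover have "(\<Sum>i\<in>I. a i powr s * f (e / a i)) = (\<Sum>i\<in>I. M (e / a i) * e powr s)"
      unfolding f_def using e I by (intro sum.cong powr_rescale) auto
    ultimately show ?thesis by (simp add: f_def sum_distrib_right)
  qed
  have f_ge: "- f e \<le> - (e0 powr s)" if "0 < e" "e \<le> e1" for e
  proof (rule subrenewal_bound[where f="\<lambda>e. - f e" and r=a and p="\<lambda>i. a i powr s", OF I(1) l(5,1,3,2)])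
    show "- f e \<le> (\<Sum>i\<in>I. a i powr s * - f (e / a i))" if "0 < e" "e \<le> e0" for e
      using super[OF that] by (simp add: sum_negf)
    show "- f e \<le> - (e0 powr s)" if e: "e0 < e" "e \<le> e0 / l" for e
    proof -
      have "dist u k \<le> C * e" using e e0 mult_right_mono[of e0 e "dist u k"] by (simp add: C_def field_simps)
      then have "ball_packing U K C e {u}"
        using u k e e0 e1 by (auto simp: ball_packing_def disjoint_family_on_def)
      then have "1 \<le> M e" using M_ge[of e "{u}"] e e0 by simp
      moreover have "e0 powr s \<le> e powr s" using e e0 s by (intro powr_mono2) auto
      ultimately show ?thesis
        using mult_mono[of 1 "real (M e)" "e0 powr s" "e powr s"] by (simp add: f_def)
    qed
    show "(\<Sum>i\<in>I. a i powr s) * - (e0 powr s) \<le> - (e0 powr s)"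
      using \<theta> mult_right_mono[of 1 \<theta> "e0 powr s"] by (simp add: \<theta>_def)
  qed (use that e0 in auto)
  \<comment> \<open>The weights divided by \<theta> have total 1; relative to them the growth of
    \<open>f\<close> is a downward drift of the nonnegative function \<open>B - f\<close>.\<close>
  show False
  proof (rule no_negative_drift[where f="\<lambda>e. B - f e" and r=a and p="\<lambda>i. a i powr s / \<theta>" and J=I
        and \<kappa>="(\<theta> - 1) * e0 powr s" and S=B, OF I(1) _ l(1,4)])
    show "(\<Sum>i\<in>I. a i powr s / \<theta>) \<le> 1" using \<theta> by (simp flip: sum_divide_distrib \<theta>_def)
    show "B - f e \<le> (\<Sum>i\<in>I. a i powr s / \<theta> * (B - f (e / a i))) - (\<theta> - 1) * e0 powr s"
      if e: "0 < e" "e \<le> e0" for e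
    proof -
      define T where "T = (\<Sum>i\<in>I. a i powr s * f (e / a i))"
      have T_le: "T \<le> f e" using super e by (simp add: T_def)
      \<comment> \<open>This lower bound for \<open>T\<close> makes the excess of \<open>T\<close>
        over \<open>T / \<theta>\<close> at least \<open>(\<theta> - 1) * e0 powr s\<close>, the
        drift.\<close>
      have "\<theta> * e0 powr s = (\<Sum>i\<in>I. a i powr s * e0 powr s)" by (simp add: \<theta>_def sum_distrib_right)
      also have "\<dots> \<le> T"
        unfolding T_def
      proof (intro sum_mono mult_left_mono)
        fix i assume i: "i \<in> I"
        have "e / a i \<le> e0 / l" using e l(1) l(5)[OF i] by (intro frac_le) auto
        then show "e0 powr s \<le> f (e / a i)" using f_ge[of "e / a i"] e e0 I(2)[OF i] by simp
      qed simp
      finally have "(\<theta> - 1) * (\<theta> * e0 powr s) \<le> (\<theta> - 1) * T" using \<theta> by (intro mult_left_mono) auto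
      then have "T / \<theta> + (\<theta> - 1) * e0 powr s \<le> T" using \<theta> by (simp add: field_simps)
      moreover have "(\<Sum>i\<in>I. a i powr s / \<theta> * (B - f (e / a i))) = B - T / \<theta>"
      proof -
        have "(\<Sum>i\<in>I. a i powr s / \<theta> * (B - f (e / a i))) = (\<Sum>i\<in>I. a i powr s * (B - f (e / a i))) / \<theta>"
          by (simp add: sum_divide_distrib)
        also have "(\<Sum>i\<in>I. a i powr s * (B - f (e / a i))) = \<theta> * B - T"
          by (simp add: T_def \<theta>_def right_diff_distrib sum_subtractf sum_distrib_right)
        finally show ?thesis using \<theta> by (simp add: diff_divide_distrib)
      qed
      ultimately show ?thesis using T_le by simp
    qed
    show "0 \<le> B - f e \<and> B - f e \<le> B" if "0 < e" "e \<le> e0" for e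
      using f_le[of e] that e0 by (simp add: f_def)
  qed (use \<theta> l e0 in auto)
qed

section \<open>Separation conditions\<close>

text \<open>Needed so that images of balls are full balls in
  \<open>similar_image_ball\<close>.\<close>

lemma contracting_similitude_surj:
  assumes "contracting_similitude f"
  shows "surj f"
proof -
  obtain a Q t where *: "0 < a" "orthogonal_transformation Q" "f = (\<lambda>x. a *\<^sub>R Q x + t)"
    using assms unfolding contracting_similitude_def by blast
  have "y \<in> range f" for y
  proof -
    obtain x where "Q x = (y - t) /\<^sub>R a"
      using orthogonal_transformation_surj[OF *(2)] by (metis surjD)
    then have "f x = y" using * by simp
    then show ?thesis by blast
  qed
  then show ?thesis by blast
qed

lemma similitude_IFS_ratios:
  assumes "similitude_IFS m \<phi>"
  obtains a where "\<And>i. i \<in> {1..m} \<Longrightarrow> 0 < a i \<and> a i < 1"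
    "\<And>i x y. i \<in> {1..m} \<Longrightarrow> dist (\<phi> i x) (\<phi> i y) = a i * dist x y"
    "\<And>i. i \<in> {1..m} \<Longrightarrow> surj (\<phi> i)"
proof -
  have "\<exists>a. 0 < a \<and> a < 1 \<and> (\<forall>x y. dist (\<phi> i x) (\<phi> i y) = a * dist x y)" if "i \<in> {1..m}" for i
    using assms that contracting_similitude_dist unfolding similitude_IFS_def by metis
  then obtain a where "\<And>i. i \<in> {1..m} \<Longrightarrow>
      0 < a i \<and> a i < 1 \<and> (\<forall>x y. dist (\<phi> i x) (\<phi> i y) = a i * dist x y)"
    by metis
  then show ?thesis
    using that[of a] assms contracting_similitude_surj unfolding similitude_IFS_def by blast
qed

theorem theorem1p1:
  fixes K :: "(real ^ 'd) set" and m :: nat and \<phi> :: "nat \<Rightarrow> real ^ 'd \<Rightarrow> real ^ 'd"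
  assumes "similitude_IFS m \<phi>"
    and "is_attractor m \<phi> K"
    and "\<not> is_singleton K"
    and "open_set_condition m \<phi>"
    and "\<not> strong_separation_condition m \<phi>"
  shows "\<not> (\<exists>n \<psi>. similitude_IFS n \<psi> \<and> is_attractor n \<psi> K \<and> strong_separation_condition n \<psi>)"
proof
  assume "\<exists>n \<psi>. similitude_IFS n \<psi> \<and> is_attractor n \<psi> K \<and> strong_separation_condition n \<psi>"
  then obtain n \<psi> where \<psi>: "similitude_IFS n \<psi>" "is_attractor n \<psi> K" "strong_separation_condition n \<psi>"
    by blast
  have K: "K \<noteq> {}" "compact K" "K = (\<Union>i\<in>{1..m}. \<phi> i ` K)" "K = (\<Union>j\<in>{1..n}. \<psi> j ` K)"
    using assms(2) \<psi>(2) unfolding is_attractor_def by blast+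
  obtain a where a: "\<And>i. i \<in> {1..m} \<Longrightarrow> 0 < a i \<and> a i < 1"
      "\<And>i x y. i \<in> {1..m} \<Longrightarrow> dist (\<phi> i x) (\<phi> i y) = a i * dist x y"
      "\<And>i. i \<in> {1..m} \<Longrightarrow> surj (\<phi> i)"
    using similitude_IFS_ratios[OF assms(1)] by metis
  obtain r where r: "\<And>j. j \<in> {1..n} \<Longrightarrow> 0 < r j \<and> r j < 1"
      "\<And>j x y. j \<in> {1..n} \<Longrightarrow> dist (\<psi> j x) (\<psi> j y) = r j * dist x y"
    using similitude_IFS_ratios[OF \<psi>(1)] by metis
  have cpt: "compact (\<phi> i ` K)" if "i \<in> {1..m}" for i
    using compact_similar_image[OF K(2) _ a(2)] a(1) that by blast
  have cpt': "compact (\<psi> j ` K)" if "j \<in> {1..n}" for j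
    using compact_similar_image[OF K(2) _ r(2)] r(1) that by blast

  \<comment> \<open>Strong separation speaks of some attractor of \<psi>; uniqueness identifies it
    with \<open>K\<close>.\<close>
  have "disjoint_family_on (\<lambda>j. \<psi> j ` K) {1..n}"
    using \<psi>(3) is_attractor_unique[OF \<psi>(1,2)] unfolding strong_separation_condition_def by metis
  then obtain \<delta> where \<delta>: "0 < \<delta>"
      "\<And>i j x y. i \<in> {1..n} \<Longrightarrow> j \<in> {1..n} \<Longrightarrow> i \<noteq> j \<Longrightarrow> x \<in> \<psi> i ` K \<Longrightarrow> y \<in> \<psi> j ` K \<Longrightarrow> \<delta> \<le> dist x y"
    using separated_compact_family[of "{1..n}" "\<lambda>j. \<psi> j ` K"] cpt' by (metis (no_types, lifting) finite_atLeastAtMost)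

  define c where "c e = real (ncomp e K)" for e
  have c_nonneg: "0 \<le> c e" for e by (simp add: c_def)
  have c_mono: "c e' \<le> c e" if "0 < e" "e \<le> e'" for e e'
    unfolding c_def using ncomp_antimono[OF K(2) that] by simp
  have c_r: "c e = (\<Sum>j\<in>{1..n}. c (e / r j))" if e: "0 < e" "e \<le> \<delta>" for e
  proof -
    have "ncomp e K = ncomp e (\<Union>j\<in>{1..n}. \<psi> j ` K)" using K(4) by simp
    also have "\<dots> = (\<Sum>j\<in>{1..n}. ncomp e (\<psi> j ` K))"
      using cpt' e \<delta>(2) by (intro ncomp_Un_separated) (auto intro: order_trans)
    also have "\<dots> = (\<Sum>j\<in>{1..n}. ncomp (e / r j) K)"
      using ncomp_similar[OF K(2) e(1) _ r(2)] r(1) by (intro sum.cong) auto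
    finally show ?thesis by (simp add: c_def)
  qed

  obtain i j where ij: "i \<in> {1..m}" "j \<in> {1..m}" "i \<noteq> j" "\<phi> i ` K \<inter> \<phi> j ` K \<noteq> {}"
    using assms(2,5) unfolding strong_separation_condition_def disjoint_family_on_def by blast
  \<comment> \<open>The counts are integers, so the strict inequality for meeting pieces becomes a
    defect of at least 1 at every scale.\<close>
  have c_a: "c e + 1 \<le> (\<Sum>i\<in>{1..m}. c (e / a i))" if e: "0 < e" for e
  proof -
    have "ncomp e K = ncomp e (\<Union>i\<in>{1..m}. \<phi> i ` K)" using K(3) by simp
    also have "\<dots> < (\<Sum>i\<in>{1..m}. ncomp e (\<phi> i ` K))"
      using cpt e ij by (intro ncomp_Un_less[of "{1..m}" _ e i j]) auto
    also have "\<dots> = (\<Sum>i\<in>{1..m}. ncomp (e / a i) K)"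
      using ncomp_similar[OF K(2) e _ a(2)] a(1) by (intro sum.cong) auto
    finally have "ncomp e K + 1 \<le> (\<Sum>i\<in>{1..m}. ncomp (e / a i) K)" by simp
    then have "real (ncomp e K + 1) \<le> real (\<Sum>i\<in>{1..m}. ncomp (e / a i) K)" by (rule of_nat_mono)
    then show ?thesis by (simp add: c_def)
  qed

  have "1 \<le> card {1..n}" using \<psi>(1) by (simp add: similitude_IFS_def)
  then obtain s where s: "0 \<le> s" "(\<Sum>j\<in>{1..n}. r j powr s) = 1"
    using Moran_exponent_exists[of "{1..n}" r] r(1) by blast
  obtain S where S: "\<And>e. 0 < e \<Longrightarrow> e \<le> \<delta> \<Longrightarrow> c e * e powr s \<le> S"
    using renewal_growth_bound[OF finite_atLeastAtMost r(1) s c_nonneg c_mono \<delta>(1) c_r] by blast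
  obtain U where U: "open U" "U \<noteq> {}" "\<And>i. i \<in> {1..m} \<Longrightarrow> \<phi> i ` U \<subseteq> U"
      "disjoint_family_on (\<lambda>i. \<phi> i ` U) {1..m}"
    using assms(4) unfolding open_set_condition_def by blast
  \<comment> \<open>The exponent \<open>s\<close> belongs to \<psi>, but the weights are those of
    \<phi>: strong separation of \<psi> bounds packings by \<open>c e\<close>, hence by a multiple
    of \<open>e powr - s\<close>, and the open set condition of \<phi> does the rest.\<close>
  have "(\<Sum>i\<in>{1..m}. a i powr s) \<le> 1"
  proof (rule OSC_exponent_le[where a=a and \<phi>=\<phi> and K=K and U=U and \<delta>=\<delta>])
    fix C
    define L where "L = (\<bar>C + diameter K / \<delta>\<bar> + 1) ^ DIM(real ^ 'd)"
    have "card E * e powr s \<le> L * S" if e: "0 < e" "e \<le> \<delta>" and E: "ball_packing U K C e E" for e E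
    proof -
      have "real (card E) \<le> L * c e"
        unfolding L_def c_def
        using chain_diameter[OF K(2,4) _ r \<delta> e(1)]
        by (intro ball_packing_card_le[OF K(2) e(1) _ E]) auto
      then have "card E * e powr s \<le> L * c e * e powr s" by (intro mult_right_mono) auto
      also have "\<dots> \<le> L * S"
        unfolding mult.assoc using S e by (intro mult_left_mono) (auto simp: L_def)
      finally show ?thesis .
    qed
    then show "\<exists>B. \<forall>e E. 0 < e \<and> e \<le> \<delta> \<and> ball_packing U K C e E \<longrightarrow> card E * e powr s \<le> B"
      by blast
  next
    show "\<phi> i ` K \<subseteq> K" if "i \<in> {1..m}" for i using K(3) that by blast
  qed (use a K(1) U \<delta>(1) s(1) in auto)
  from incompatible_renewal[OF finite_atLeastAtMost a(1) finite_atLeastAtMost r(1) s this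
      c_nonneg c_mono \<delta>(1) c_r c_a]
  show False .
qed

end
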